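(* Let $\varphi:[0,\infty]\to[0,\infty]$ be a convex non-decreasing function such that $$\int_{\delta_*}^{\infty}\frac{d\tau}{\tau\,\varphi^{-1}(\tau)}<\infty$$ for some $\delta_*\in(\tau_0,\infty)$, where $\tau_0=\varphi(0)$. Then for every $n\ge2$ there is a diffeomorphism $f$ of the punctured unit ball $\mathbb{B}^n\setminus\{0\}$ onto a ring $\{x\in\mathbb{R}^n:1<|x|<R\}$ (for some $R\in(1,\infty)$) such that $$\int_{\mathbb{B}^n}\varphi\big(K_O(x,f)\big)\,dm(x)<\infty$$ but $f$ cannot be extended by continuity to $0$.
   Context: $\mathbb{B}^n=\{x\in\mathbb{R}^n:|x|<1\}$; $dm$ is Lebesgue measure. $\varphi^{-1}(\tau)=\inf\{t\in[0,\infty]:\varphi(t)\ge\tau\}$, with $\inf\emptyset=\infty$; convention $1/\infty=0$. Convexity of $\varphi$: $\varphi(\lambda t_1+(1-\lambda)t_2)\le\lambda\varphi(t_1)+(1-\lambda)\varphi(t_2)$ for all $t_1,t_2\in[0,\infty]$, $\lambda\in[0,1]$. Outer dilatation: at a point $x$ of differentiability of $f$, $K_O(x,f)=\|f'(x)\|^n/|J(x,f)|$ if $J(x,f)=\det f'(x)\neq0$, $K_O(x,f)=1$ if $f'(x)=0$, and $K_O(x,f)=\infty$ otherwise; $\|f'(x)\|=\sup_{h\ne0}|f'(x)h|/|h|$. *)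

theory Defs
  imports "HOL-Analysis.Analysis"
begin

(* Convexity of a function from [0,\<infinity>] to [0,\<infinity>]. Products are those of ennreal,
   so 0 * \<infinity> = 0. *)
definition convex_ennreal :: "(ennreal \<Rightarrow> ennreal) \<Rightarrow> bool" where
  "convex_ennreal \<phi> \<longleftrightarrow>
     (\<forall>t\<^sub>1 t\<^sub>2. \<forall>\<mu>\<in>{0..1::real}.
        \<phi> (ennreal \<mu> * t\<^sub>1 + ennreal (1 - \<mu>) * t\<^sub>2)
          \<le> ennreal \<mu> * \<phi> t\<^sub>1 + ennreal (1 - \<mu>) * \<phi> t\<^sub>2)"

(* The infimum is taken in [0,\<infinity>], so it is \<infinity> for the empty set. *)
definition gen_inverse :: "(ennreal \<Rightarrow> ennreal) \<Rightarrow> ennreal \<Rightarrow> ennreal" where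
  "gen_inverse \<phi> \<tau> = Inf {t. \<tau> \<le> \<phi> t}"

(* The value \<infinity> is also assigned at points where f is not differentiable. *)
definition outer_dilatation :: "(real^'n \<Rightarrow> real^'n) \<Rightarrow> real^'n \<Rightarrow> ennreal" where
  "outer_dilatation f x =
     (let f' = frechet_derivative f (at x); J = det (matrix f') in
      if f differentiable (at x) \<and> J \<noteq> 0 then ennreal (onorm f' ^ CARD('n) / \<bar>J\<bar>)
      else if f differentiable (at x) \<and> f' = (\<lambda>h. 0) then 1
      else \<infinity>)"

(* Meant for open S, where the derivative at a point of S does not depend on
   the values of f outside S. *)
definition C1_on ::
  "'a::real_normed_vector set \<Rightarrow> ('a \<Rightarrow> 'b::real_normed_vector) \<Rightarrow> bool" where
  "C1_on S f \<longleftrightarrow>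
     (\<exists>f' :: 'a \<Rightarrow> 'a \<Rightarrow>\<^sub>L 'b.
        (\<forall>x\<in>S. (f has_derivative blinfun_apply (f' x)) (at x)) \<and> continuous_on S f')"

(* Diffeomorphisms between open sets are understood in the C^1 sense. *)
definition diffeomorphism ::
  "'a::real_normed_vector set \<Rightarrow> 'b::real_normed_vector set \<Rightarrow> ('a \<Rightarrow> 'b) \<Rightarrow> bool" where
  "diffeomorphism S T f \<longleftrightarrow> (\<exists>g. homeomorphism S T f g \<and> C1_on S f \<and> C1_on T g)"

end

theory Submission
  imports Defs
begin

text \<open>
  The map is radial, \<open>f x = \<rho> \<bar>x\<bar> x / \<bar>x\<bar>\<close>, with \<open>\<rho> 0 = 1\<close>; it has no limit at \<open>0\<close> because it
  is odd and \<open>\<bar>f x\<bar> \<ge> 1\<close>. If \<open>r \<rho>' r \<le> \<rho> r\<close>, its outer dilatation at radius \<open>r\<close> is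
  \<open>\<rho> r / (r \<rho>' r)\<close>. Take \<open>\<rho> r = 1 + (\<Sum>j. a\<^sub>j r / (r + 2\<^sup>-\<^sup>j))\<close>: the \<open>j\<close>-th summand alone bounds the
  dilatation by \<open>40 / a\<^sub>j\<close> on the shell \<open>2\<^sup>-\<^sup>j\<^sup>-\<^sup>1 \<le> r \<le> 2\<^sup>-\<^sup>j\<close>. The integral condition says, by dyadic
  condensation, that \<open>1 / \<phi>\<^sup>-\<^sup>1(M 2\<^sup>j)\<close> is summable, so \<open>a\<close> can be chosen summable and still slightly
  larger than \<open>40\<close> times this sequence. Then \<open>\<phi>(K\<^sub>O) \<le> M 2\<^sup>j\<close> on the \<open>j\<close>-th shell, that is,
  \<open>\<phi>(K\<^sub>O)\<close> is of order at most \<open>1 / r\<close>, which is integrable near \<open>0\<close> in dimension at least two.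
\<close>

section \<open>Dyadic condensation of the integral condition\<close>

lemma inverse_inverse_ennreal: "inverse (inverse x) = (x::ennreal)"
  by (metis divide_ennreal_def mult_1 one_divide_one_divide_ennreal)

lemma inverse_ennreal_antimono: "x \<le> y \<Longrightarrow> inverse y \<le> inverse (x::ennreal)"
  including ennreal.lifting by transfer (rule ereal_inverse_antimono)

lemma gen_inverse_mono: "mono (gen_inverse \<phi>)"
  unfolding gen_inverse_def by (intro monoI Inf_superset_mono) (auto intro: order_trans)

text \<open>A point \<open>t\<close> with \<open>\<tau> \<le> \<phi> t\<close> competes in the
  infimum. At the infimum itself \<open>\<phi>\<close> may already reach \<open>\<tau>\<close>, so
  the argument \<open>40 / a j\<close> used later has to stay strictly below it.\<close>

lemma less_gen_inverseD: "t < gen_inverse \<phi> \<tau> \<Longrightarrow> \<phi> t < \<tau>"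
  unfolding gen_inverse_def by (metis Inf_lower linorder_not_less mem_Collect_eq)

text \<open>On each dyadic interval the integrand is at least its value at the right endpoint, since
  \<open>\<psi>\<close> is monotone, and the interval is half as long as that endpoint is large. The
  factor \<open>\<tau>\<close> thus cancels against the length up to 1/2.\<close>

lemma suminf_inverse_dyadic_finite:
  fixes \<psi> :: "ennreal \<Rightarrow> ennreal" and \<delta> :: real
  assumes "mono \<psi>" and "\<delta> > 0"
    and fin: "(\<integral>\<^sup>+\<tau>\<in>{\<delta>..}. 1 / (ennreal \<tau> * \<psi> (ennreal \<tau>)) \<partial>lebesgue) < \<infinity>"
  shows "(\<Sum>j. inverse (\<psi> (ennreal (\<delta> * 2 ^ Suc j)))) < \<infinity>"
proof -
  define A where "A j = {\<delta> * 2 ^ j <.. \<delta> * 2 ^ Suc j}" for j :: nat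
  define c where "c j = inverse (ennreal (\<delta> * 2 ^ Suc j)) * inverse (\<psi> (ennreal (\<delta> * 2 ^ Suc j)))" for j
  have disj: "disjoint_family A"
  proof -
    have "A i \<inter> A j = {}" if "i < j" for i j
    proof -
      have "(2::real) ^ Suc i \<le> 2 ^ j" using that by (intro power_increasing) auto
      then have "\<delta> * 2 ^ Suc i \<le> \<delta> * 2 ^ j" using \<open>\<delta> > 0\<close> by (intro mult_left_mono) auto
      then show ?thesis unfolding A_def by auto
    qed
    then show ?thesis unfolding disjoint_family_on_def by (metis Int_commute linorder_neqE_nat)
  qed
  have le: "(\<Sum>j. c j * indicator (A j) \<tau>) \<le> 1 / (ennreal \<tau> * \<psi> (ennreal \<tau>)) * indicator {\<delta>..} \<tau>" for \<tau>
  proof (cases "\<exists>j. \<tau> \<in> A j")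
    case True
    then obtain j where j: "\<tau> \<in> A j" by blast
    have "\<delta> * 1 \<le> \<delta> * 2 ^ j" using \<open>\<delta> > 0\<close> by (intro mult_left_mono) auto
    then have tau: "\<delta> < \<tau>" "\<tau> \<le> \<delta> * 2 ^ Suc j" using j by (auto simp: A_def)
    have "(\<Sum>j. c j * indicator (A j) \<tau>) = c j"
      by (rule suminf_cmult_indicator[OF disj j])
    also have "\<dots> \<le> inverse (ennreal \<tau>) * inverse (\<psi> (ennreal \<tau>))"
      unfolding c_def using tau \<open>mono \<psi>\<close>
      by (intro mult_mono inverse_ennreal_antimono) (auto simp: ennreal_leI monoD)
    \<comment> \<open>Splitting the inverse is sound because \<open>\<tau>\<close> is positive and
      finite; a product \<open>0 * \<infinity>\<close> would break it.\<close>
    also have "\<dots> = 1 / (ennreal \<tau> * \<psi> (ennreal \<tau>))"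
      using tau \<open>\<delta> > 0\<close> by (simp add: divide_ennreal_def ennreal_inverse_mult')
    finally show ?thesis using tau by simp
  next
    case False
    then show ?thesis by simp
  qed
  have meas: "emeasure lebesgue (A j) = ennreal (\<delta> * 2 ^ j)" for j
    using \<open>\<delta> > 0\<close> unfolding A_def by simp
  have weight: "c j * ennreal (\<delta> * 2 ^ j) = inverse 2 * inverse (\<psi> (ennreal (\<delta> * 2 ^ Suc j)))" for j
  proof -
    have "inverse (ennreal (\<delta> * 2 ^ Suc j)) * ennreal (\<delta> * 2 ^ j)
        = ennreal (inverse (\<delta> * 2 ^ Suc j) * (\<delta> * 2 ^ j))"
      using \<open>\<delta> > 0\<close> by (subst inverse_ennreal, simp, subst ennreal_mult[symmetric]) auto
    also have "inverse (\<delta> * 2 ^ Suc j) * (\<delta> * 2 ^ j) = 1 / 2"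
      using \<open>\<delta> > 0\<close> by (simp add: field_simps)
    finally show ?thesis unfolding c_def by (metis ennreal_half mult.assoc mult.commute)
  qed
  have "inverse 2 * (\<Sum>j. inverse (\<psi> (ennreal (\<delta> * 2 ^ Suc j)))) = (\<Sum>j. c j * emeasure lebesgue (A j))"
    by (simp only: meas weight ennreal_suminf_cmult)
  also have "\<dots> = (\<Sum>j. \<integral>\<^sup>+\<tau>. c j * indicator (A j) \<tau> \<partial>lebesgue)"
    by (subst nn_integral_cmult_indicator) (auto simp: A_def)
  also have "\<dots> = (\<integral>\<^sup>+\<tau>. (\<Sum>j. c j * indicator (A j) \<tau>) \<partial>lebesgue)"
    by (rule nn_integral_suminf[symmetric]) (auto simp: A_def intro!: borel_measurable_times_ennreal borel_measurable_indicator)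
  also have "\<dots> \<le> (\<integral>\<^sup>+\<tau>\<in>{\<delta>..}. 1 / (ennreal \<tau> * \<psi> (ennreal \<tau>)) \<partial>lebesgue)"
    by (intro nn_integral_mono le)
  also note fin
  finally show ?thesis by (auto simp: ennreal_mult_less_top less_top[symmetric])
qed

text \<open>Summability permits dropping the first \<open>N\<close> terms so that the rest is small;
  the shift of index is absorbed in the constant \<open>M\<close>.\<close>

lemma dyadic_weights:
  fixes \<phi> :: "ennreal \<Rightarrow> ennreal" and \<delta> :: real
  assumes "\<delta> > 0"
    and "(\<integral>\<^sup>+\<tau>\<in>{\<delta>..}. 1 / (ennreal \<tau> * gen_inverse \<phi> (ennreal \<tau>)) \<partial>lebesgue) < \<infinity>"
  obtains a :: "nat \<Rightarrow> real" and M :: real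
  where "M > 0" "\<And>j. a j > 0" "summable a" "suminf a \<le> 4"
    "\<And>j. \<phi> (ennreal (40 / a j)) < ennreal (M * 2 ^ j)"
proof -
  define b where "b j = inverse (gen_inverse \<phi> (ennreal (\<delta> * 2 ^ Suc j)))" for j
  define g where "g j = enn2real (b j)" for j
  have fin: "(\<Sum>j. b j) < \<infinity>"
    unfolding b_def by (rule suminf_inverse_dyadic_finite[OF gen_inverse_mono assms])
  have b: "b j = ennreal (g j)" for j
    unfolding g_def using ennreal_suminf_lessD[OF fin, of j] by (simp add: less_top)
  have g0: "g j \<ge> 0" for j by (simp add: g_def)
  have "summable g"
    using fin unfolding b by (intro summable_suminf_not_top g0) auto
  \<comment> \<open>The bound 1/20 suffices because 41/20 + 1 \<le> 4, the bound required of
    \<open>suminf a\<close>.\<close>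
  then obtain N where N: "norm (\<Sum>i. g (i + N)) < 1 / 20"
    using suminf_exist_split[of "1/20" g] by auto
  have sg: "summable (\<lambda>i. g (i + N))" using \<open>summable g\<close> by (rule summable_ignore_initial_segment)
  \<comment> \<open>The term \<open>(1/2) ^ Suc j\<close> keeps \<open>a\<close> positive where the generalized inverse is infinite.\<close>
  define a where "a j = 41 * g (j + N) + (1/2) ^ Suc j" for j
  \<comment> \<open>Chosen so that \<open>M * 2 ^ j = \<delta> * 2 ^ Suc (j + N)\<close>.\<close>
  define M where "M = \<delta> * 2 ^ Suc N"
  have pos: "a j > 0" for j unfolding a_def using g0[of "j + N"] by (intro add_nonneg_pos) auto
  have "a sums (41 * (\<Sum>i. g (i + N)) + 1)"
    unfolding a_def by (intro sums_add sums_mult summable_sums sg power_half_series)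
  then have sm: "summable a" "suminf a \<le> 4" using N by (auto simp: sums_iff)
  have lt: "\<phi> (ennreal (40 / a j)) < ennreal (M * 2 ^ j)" for j
  proof -
    have "ennreal (40 / a j) < inverse (b (j + N))"
    proof (cases "g (j + N) = 0")
      \<comment> \<open>Here the generalized inverse is infinite and exceeds every finite
        number.\<close>
      case True
      then show ?thesis by (simp add: b less_top)
    next
      case False
      then have gp: "g (j + N) > 0" using g0[of "j+N"] by simp
      \<comment> \<open>The surplus of 41 over 40 makes this strict, as
        \<open>less_gen_inverseD\<close> demands.\<close>
      have "40 * g (j + N) < a j"
        unfolding a_def using gp by (simp add: add_pos_pos)
      then have "40 / a j < inverse (g (j + N))"
        using gp pos[of j] by (simp add: field_simps)
      then show ?thesis unfolding b using gp pos[of j]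
        by (subst inverse_ennreal) (auto intro!: ennreal_lessI)
    qed
    also have "inverse (b (j + N)) = gen_inverse \<phi> (ennreal (M * 2 ^ j))"
      unfolding b_def M_def inverse_inverse_ennreal by (simp add: power_add mult_ac)
    finally show ?thesis by (rule less_gen_inverseD)
  qed
  have "M > 0" using \<open>\<delta> > 0\<close> by (simp add: M_def)
  from this pos sm lt show ?thesis by (rule that)
qed

section \<open>Determinant of a scaling plus a rank-one term\<close>

text \<open>An orthogonal \<open>T\<close> carries a coordinate axis to \<open>e\<close> and
  conjugates the map to a diagonal one with a single entry \<open>w + c\<close> and all others
  \<open>w\<close>. The derivative of a radial map has this shape.\<close>

lemma det_scaling_plus_projection:
  fixes e :: "real^'n"
  assumes e: "norm e = 1"
  shows "det (matrix (\<lambda>h. w *\<^sub>R h + c *\<^sub>R (h \<bullet> e) *\<^sub>R e)) = w ^ (CARD('n) - 1) * (w + c)"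
proof -
  obtain k :: 'n where True by blast
  define L where "L = (\<lambda>h. w *\<^sub>R h + c *\<^sub>R (h \<bullet> e) *\<^sub>R e)"
  have linL: "linear L" unfolding L_def
    by (intro linearI) (auto simp: algebra_simps)
  obtain T :: "real^'n \<Rightarrow> real^'n" where T: "orthogonal_transformation T" "T (axis k 1) = e"
    using orthogonal_transformation_exists_1[of "axis k (1::real)" e] e by auto
  define D where "D = (\<lambda>h. w *\<^sub>R h + c *\<^sub>R (h \<bullet> axis k 1) *\<^sub>R axis k (1::real) :: real^'n)"
  have linD: "linear D" unfolding D_def
    by (intro linearI) (auto simp: algebra_simps)
  have linT: "linear T" using T by (simp add: orthogonal_transformation_linear)
  have entries: "matrix D $ i $ j = (if i = j then if i = k then w + c else w else 0)" for i j
    by (simp add: matrix_def D_def inner_axis) (auto simp: axis_def)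
  have "L \<circ> T = T \<circ> D"
  proof
    fix h
    have "T h \<bullet> e = h \<bullet> axis k 1"
      using T by (metis orthogonal_transformation_def)
    then show "(L \<circ> T) h = (T \<circ> D) h"
      unfolding L_def D_def using T(2) linT by (simp add: linear_add linear_scale)
  qed
  then have "matrix L ** matrix T = matrix T ** matrix D"
    by (metis matrix_compose linL linT linD)
  then have "det (matrix L) * det (matrix T) = det (matrix T) * det (matrix D)"
    by (metis det_mul)
  moreover have "det (matrix T) \<noteq> 0"
    using T by (metis orthogonal_transformation_inj det_nz_iff_inj linT)
  ultimately have "det (matrix L) = det (matrix D)" by simp
  also have "det (matrix D) = (\<Prod>i\<in>UNIV. matrix D $ i $ i)"
    by (rule det_diagonal) (simp add: entries)
  also have "\<dots> = (\<Prod>i\<in>UNIV. if i = k then w + c else w)"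
    by (simp add: entries)
  also have "\<dots> = (w + c) * (\<Prod>i\<in>UNIV - {k}. if i = k then w + c else w)"
    by (subst prod.remove[of _ k]) auto
  also have "(\<Prod>i\<in>UNIV - {k}. if i = k then w + c else w) = w ^ (CARD('n) - 1)"
    by (simp add: card_Diff_singleton)
  finally show ?thesis unfolding L_def by (simp add: mult.commute)
qed

section \<open>The radial profile and its inverse\<close>

text \<open>With \<open>q = (1/2) ^ j\<close>, the derivative of \<open>r / (r + q)\<close> times
  \<open>r\<close> is \<open>r * q / (r + q)\<^sup>2\<close>: at most 1/4 for all
  \<open>r > 0\<close>, and at least 1/8 for \<open>q / 2 \<le> r \<le> q\<close>. The upper bound
  gives \<open>r * \<rho>' r \<le> 1 \<le> \<rho> r\<close>, the lower one the dilatation bound on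
  the shell.\<close>

lemma radial_profile:
  fixes a :: "nat \<Rightarrow> real"
  assumes pos: "\<And>j. a j > 0" and sm: "summable a" and le4: "suminf a \<le> 4"
  obtains \<rho> \<rho>' :: "real \<Rightarrow> real"
  where "\<rho> 0 = 1" "continuous_on {0..} \<rho>"
    "\<And>r. r > 0 \<Longrightarrow> (\<rho> has_real_derivative \<rho>' r) (at r)"
    "continuous_on {0<..} \<rho>'"
    "\<And>r. r > 0 \<Longrightarrow> \<rho>' r > 0"
    "\<And>r. r > 0 \<Longrightarrow> r * \<rho>' r \<le> \<rho> r"
    "\<And>j r. (1/2) ^ Suc j \<le> r \<Longrightarrow> r \<le> (1/2) ^ j \<Longrightarrow> \<rho> r / (r * \<rho>' r) \<le> 40 / a j"
proof -
  define q :: "nat \<Rightarrow> real" where "q j = (1/2) ^ j" for j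
  define p where "p j r = a j * (r / (r + q j))" for j r
  define d where "d j r = a j * (q j / (r + q j)\<^sup>2)" for j r
  define \<rho> where "\<rho> r = 1 + (\<Sum>j. p j r)" for r
  define \<rho>' where "\<rho>' r = (\<Sum>j. d j r)" for r
  have q: "q j > 0" for j by (simp add: q_def)
  have p_bound: "0 \<le> p j r \<and> p j r \<le> a j" if "r \<ge> 0" for j r
  proof -
    have "0 \<le> r / (r + q j)" "r / (r + q j) \<le> 1" using that q[of j] by simp_all
    then show ?thesis
      unfolding p_def using pos[of j] by (intro conjI mult_nonneg_nonneg mult_left_le) auto
  qed
  have d_pos: "d j r > 0" if "r > 0" for j r
    unfolding d_def using that pos[of j] q[of j] by (intro mult_pos_pos divide_pos_pos) auto
  have d_bound: "r * d j r \<le> a j / 4" if "r > 0" for j r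
  proof -
    have "4 * (r * q j) \<le> (r + q j)\<^sup>2"
      using zero_le_power2[of "r - q j"] by (simp add: power2_eq_square algebra_simps)
    then have "r * q j / (r + q j)\<^sup>2 \<le> 1 / 4"
      using that q[of j] by (simp add: divide_simps)
    then have "a j * (r * q j / (r + q j)\<^sup>2) \<le> a j * (1 / 4)"
      using pos[of j] by (intro mult_left_mono) auto
    then show ?thesis by (simp add: d_def mult_ac)
  qed
  have p_sm: "summable (\<lambda>j. p j r)" if "r \<ge> 0" for r
    using p_bound[OF that] by (intro summable_comparison_test'[OF sm, of 0]) auto
  \<comment> \<open>At 0 the terms \<open>d j 0 = a j / q j\<close> need not be summable, so the
    derivative series is controlled only on half-lines \<open>{c<..}\<close> with
    \<open>c > 0\<close>; \<open>c = r / 2\<close> serves for the point \<open>r\<close>.\<close>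
  have d_le: "norm (d j r) \<le> a j / (4 * c)" if "r \<in> {c<..}" "c > 0" for j r c
  proof -
    have "c * d j r \<le> r * d j r" using that d_pos[of r j] by (intro mult_right_mono) auto
    also have "\<dots> \<le> a j / 4" using d_bound that by simp
    finally show ?thesis using that d_pos[of r j] by (simp add: field_simps)
  qed
  have d_unif: "uniform_limit {c<..} (\<lambda>n r. \<Sum>j<n. d j r) \<rho>' sequentially" if "c > 0" for c
    unfolding \<rho>'_def[abs_def]
    by (rule Weierstrass_m_test[OF d_le]) (use that sm in \<open>auto intro: summable_divide\<close>)
  have d_sm: "summable (\<lambda>j. d j r)" if "r > 0" for r
    by (rule summable_comparison_test'[of "\<lambda>j. a j / (4 * (r/2))" 0])
      (use that sm d_le[of r "r/2"] in \<open>auto intro: summable_divide\<close>)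
  have "\<rho> 0 = 1" by (simp add: \<rho>_def p_def)
  moreover have "continuous_on {0..} \<rho>"
  proof -
    have "uniform_limit {0..} (\<lambda>n r. \<Sum>j<n. p j r) (\<lambda>r. \<Sum>j. p j r) sequentially"
      by (rule Weierstrass_m_test[where M = a]) (use sm p_bound in auto)
    moreover have "continuous_on {0..} (\<lambda>r. \<Sum>j<n. p j r)" for n
    proof -
      have "t + q j \<noteq> 0" if "t \<ge> 0" for t j using that q[of j] by auto
      then show ?thesis unfolding p_def by (intro continuous_intros) auto
    qed
    ultimately have "continuous_on {0..} (\<lambda>r. \<Sum>j. p j r)"
      by (intro uniform_limit_theorem[of _ "\<lambda>n r. \<Sum>j<n. p j r" sequentially]) auto
    then show ?thesis unfolding \<rho>_def[abs_def] by (intro continuous_intros)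
  qed
  moreover have "(\<rho> has_real_derivative \<rho>' r) (at r)" if "r > 0" for r
  proof -
    have "((\<lambda>r. \<Sum>j. p j r) has_real_derivative (\<Sum>j. d j r)) (at r)"
    proof (rule has_field_derivative_series'(2)[of "{r/2<..}" p d r])
      fix j t assume t: "t \<in> {r/2<..}"
      then have "t + q j \<noteq> 0" using that q[of j] by auto
      then show "(p j has_real_derivative d j t) (at t within {r/2<..})"
        unfolding p_def[abs_def] d_def
        by (auto intro!: derivative_eq_intros simp: power2_eq_square algebra_simps)
    next
      show "uniformly_convergent_on {r/2<..} (\<lambda>n t. \<Sum>j<n. d j t)"
        using d_unif[of "r/2"] that by (auto simp: uniformly_convergent_on_def)
    qed (use that p_sm[of r] in \<open>auto simp: interior_open\<close>)
    then show ?thesis unfolding \<rho>_def[abs_def] \<rho>'_def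
      by (auto intro!: derivative_eq_intros)
  qed
  moreover have "continuous_on {0<..} \<rho>'"
  proof (rule continuous_at_imp_continuous_on, rule ballI)
    fix r :: real assume "r \<in> {0<..}"
    then have "r > 0" by simp
    have "continuous_on {r/2<..} (\<lambda>r. \<Sum>j<n. d j r)" for n
    proof -
      have "t + q j \<noteq> 0" if "t > r/2" for t j using that \<open>r > 0\<close> q[of j] by auto
      then show ?thesis unfolding d_def by (intro continuous_intros) auto
    qed
    then have "continuous_on {r/2<..} \<rho>'"
      by (intro uniform_limit_theorem[OF _ d_unif]) (use \<open>r > 0\<close> in auto)
    then show "isCont \<rho>' r" using \<open>r > 0\<close> by (simp add: continuous_on_eq_continuous_at)
  qed
  moreover have rho'_pos: "\<rho>' r > 0" if "r > 0" for r
    unfolding \<rho>'_def by (rule suminf_pos[OF d_sm]) (use that d_pos in auto)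
  moreover have "r * \<rho>' r \<le> \<rho> r" if "r > 0" for r
  proof -
    have "r * \<rho>' r = (\<Sum>j. r * d j r)" unfolding \<rho>'_def by (rule suminf_mult[OF d_sm[OF that], symmetric])
    also have "\<dots> \<le> (\<Sum>j. a j / 4)"
      using d_bound that d_sm[OF that] sm by (intro suminf_le) (auto intro: summable_mult summable_divide)
    \<comment> \<open>The bound 4 on \<open>suminf a\<close> is matched to the factor 1/4.\<close>
    also have "\<dots> \<le> 1" using le4 sm by (simp add: suminf_divide)
    also have "1 \<le> \<rho> r" unfolding \<rho>_def using p_bound[of r] p_sm[of r] that by (simp add: suminf_nonneg)
    finally show ?thesis .
  qed
  moreover have "\<rho> r / (r * \<rho>' r) \<le> 40 / a j" if r: "(1/2) ^ Suc j \<le> r" "r \<le> (1/2) ^ j" for j r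
  proof -
    have "r > 0" using r(1) by (rule less_le_trans[rotated]) simp
    have r': "q j \<le> 2 * r" "r \<le> q j" using r by (simp_all add: q_def)
    have "(\<Sum>j. p j r) \<le> suminf a"
      using p_bound[of r] p_sm[of r] \<open>r > 0\<close> sm by (intro suminf_le) auto
    then have up: "\<rho> r \<le> 5" unfolding \<rho>_def using le4 by simp
    \<comment> \<open>Both \<open>r \<le> q j\<close> and \<open>q j \<le> 2 * r\<close> enter,
      giving \<open>(r + q j)\<^sup>2 \<le> 8 * r * q j\<close>.\<close>
    have "(r + q j)\<^sup>2 \<le> (2 * q j)\<^sup>2" using r' \<open>r > 0\<close> by (intro power_mono) auto
    also have "\<dots> = 4 * (q j * q j)" by (simp add: power2_eq_square)
    also have "\<dots> \<le> 4 * (2 * r * q j)" using r' q[of j] by (intro mult_left_mono mult_right_mono) auto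
    finally have "1 / 8 \<le> r * q j / (r + q j)\<^sup>2" using \<open>r > 0\<close> q[of j] by (simp add: field_simps)
    then have "a j * (1 / 8) \<le> a j * (r * q j / (r + q j)\<^sup>2)"
      using pos[of j] by (intro mult_left_mono) auto
    also have "\<dots> = r * d j r" by (simp add: d_def)
    also have "\<dots> \<le> r * \<rho>' r"
    proof -
      have "sum (\<lambda>j. d j r) {j} \<le> \<rho>' r" unfolding \<rho>'_def
        using d_pos[OF \<open>r > 0\<close>] by (intro sum_le_suminf d_sm \<open>r > 0\<close>) (auto intro: less_imp_le)
      then show ?thesis using \<open>r > 0\<close> by simp
    qed
    finally have low: "a j / 8 \<le> r * \<rho>' r" by simp
    \<comment> \<open>The constant 40 is 5 times 8: \<open>\<rho> r \<le> 1 + 4\<close> in the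
      numerator, the single term \<open>a j / 8\<close> in the denominator.\<close>
    have "\<rho> r / (r * \<rho>' r) \<le> 5 / (a j / 8)"
      using up low pos[of j] by (intro frac_le) auto
    then show ?thesis by simp
  qed
  ultimately show ?thesis by (rule that)
qed

text \<open>Differentiability is asked only in the interior, since the profile may have no
  derivative at the endpoint 0; the closed interval is kept because its compactness gives continuity
  of the inverse.\<close>

lemma inverse_profile:
  fixes \<rho> \<rho>' :: "real \<Rightarrow> real"
  assumes cont: "continuous_on {a..b} \<rho>" and "a < b"
    and deriv: "\<And>r. a < r \<Longrightarrow> r < b \<Longrightarrow> (\<rho> has_real_derivative \<rho>' r) (at r)"
    and pos: "\<And>r. a < r \<Longrightarrow> r < b \<Longrightarrow> \<rho>' r > 0"
    and cont': "continuous_on {a<..<b} \<rho>'"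
  obtains \<sigma> where
    "\<rho> a < \<rho> b"
    "\<And>r. r \<in> {a<..<b} \<Longrightarrow> \<rho> r \<in> {\<rho> a<..<\<rho> b} \<and> \<sigma> (\<rho> r) = r"
    "\<And>s. s \<in> {\<rho> a<..<\<rho> b} \<Longrightarrow> \<sigma> s \<in> {a<..<b} \<and> \<rho> (\<sigma> s) = s"
    "\<And>s. s \<in> {\<rho> a<..<\<rho> b} \<Longrightarrow> (\<sigma> has_real_derivative inverse (\<rho>' (\<sigma> s))) (at s)"
    "continuous_on {\<rho> a<..<\<rho> b} (\<lambda>s. inverse (\<rho>' (\<sigma> s)))"
proof -
  have less: "\<rho> x < \<rho> y" if "a \<le> x" "x < y" "y \<le> b" for x y
    by (rule DERIV_pos_imp_increasing_open[OF \<open>x < y\<close>])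
      (use that deriv pos in \<open>force intro: continuous_on_subset[OF cont]\<close>)+
  then have inj: "inj_on \<rho> {a..b}"
    by (intro inj_onI) (metis atLeastAtMost_iff linorder_neqE_linordered_idom order_less_irrefl)
  define \<sigma> where "\<sigma> = inv_into {a..b} \<rho>"
  have img: "\<rho> ` {a..b} = {\<rho> a..\<rho> b}"
  proof
    show "\<rho> ` {a..b} \<subseteq> {\<rho> a..\<rho> b}"
      using less \<open>a < b\<close> by (force simp: le_less)
    show "{\<rho> a..\<rho> b} \<subseteq> \<rho> ` {a..b}"
      using IVT'[of \<rho> a _ b] cont \<open>a < b\<close> by (force simp: image_iff)
  qed
  have left: "\<rho> r \<in> {\<rho> a<..<\<rho> b} \<and> \<sigma> (\<rho> r) = r" if "r \<in> {a<..<b}" for r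
    using that less[of a r] less[of r b] inj unfolding \<sigma>_def by auto
  have right: "\<sigma> s \<in> {a<..<b} \<and> \<rho> (\<sigma> s) = s" if s: "s \<in> {\<rho> a<..<\<rho> b}" for s
  proof -
    have "s \<in> \<rho> ` {a..b}" using s img by auto
    then have "\<sigma> s \<in> {a..b}" "\<rho> (\<sigma> s) = s"
      unfolding \<sigma>_def by (simp_all add: inv_into_into f_inv_into_f del: atLeastAtMost_iff)
    then show ?thesis using s by (auto simp: le_less)
  qed
  have "continuous_on (\<rho> ` {a..b}) \<sigma>"
    unfolding \<sigma>_def using inj by (intro continuous_on_inv cont) auto
  then have contS: "continuous_on {\<rho> a<..<\<rho> b} \<sigma>"
    unfolding img by (rule continuous_on_subset) auto
  have der: "(\<sigma> has_real_derivative inverse (\<rho>' (\<sigma> s))) (at s)" if s: "s \<in> {\<rho> a<..<\<rho> b}" for s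
  proof (rule DERIV_inverse_function)
    show "isCont \<sigma> s" using contS s by (simp add: continuous_on_eq_continuous_at)
  qed (use right[OF s] right deriv pos s in \<open>auto simp: less_imp_neq[symmetric]\<close>)
  have "continuous_on {\<rho> a<..<\<rho> b} (\<lambda>s. inverse (\<rho>' (\<sigma> s)))"
    by (intro continuous_on_inverse continuous_on_compose2[OF cont' contS])
      (use right pos in \<open>force dest: less_imp_neq\<close>)+
  with less[OF order_refl \<open>a < b\<close> order_refl] left right der show ?thesis by (rule that)
qed

section \<open>Radial maps: derivative, invertibility and dilatation\<close>

definition radial_map :: "(real \<Rightarrow> real) \<Rightarrow> 'a::real_inner \<Rightarrow> 'a" where
  "radial_map p x = (p (norm x) / norm x) *\<^sub>R x"

text \<open>With \<open>r = norm x\<close>, the stretch is \<open>p' r\<close> along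
  \<open>x\<close> and \<open>p r / r\<close> orthogonally to it. Scaling plus a rank-one term is
  the form that \<open>det_scaling_plus_projection\<close> handles.\<close>

definition radial_deriv :: "(real \<Rightarrow> real) \<Rightarrow> (real \<Rightarrow> real) \<Rightarrow> 'a::real_inner \<Rightarrow> 'a \<Rightarrow> 'a" where
  "radial_deriv p p' x h =
     (p (norm x) / norm x) *\<^sub>R h + (p' (norm x) - p (norm x) / norm x) *\<^sub>R (h \<bullet> sgn x) *\<^sub>R sgn x"

lemma norm_radial_map: "x \<noteq> 0 \<Longrightarrow> p (norm x) \<ge> 0 \<Longrightarrow> norm (radial_map p x) = p (norm x)"
  by (simp add: radial_map_def)

lemma radial_map_compose:
  "x \<noteq> 0 \<Longrightarrow> p (norm x) > 0 \<Longrightarrow> q (p (norm x)) = norm x \<Longrightarrow> radial_map q (radial_map p x) = x"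
  unfolding radial_map_def[of q] by (simp add: norm_radial_map) (simp add: radial_map_def)

text \<open>Product rule for the scalar factor \<open>p (norm y) / norm y\<close> and the identity;
  the norm has gradient \<open>sgn x\<close> at \<open>x\<close>.\<close>

lemma has_derivative_radial_map:
  assumes "x \<noteq> 0" and p: "(p has_real_derivative p' (norm x)) (at (norm x))"
  shows "(radial_map p has_derivative radial_deriv p p' x) (at x)"
proof -
  define r where "r = norm x"
  have "r > 0" using \<open>x \<noteq> 0\<close> by (simp add: r_def)
  have "((\<lambda>t. p t / t) has_real_derivative (p' r - p r / r) / r) (at r)"
    using p \<open>r > 0\<close> unfolding r_def[symmetric]
    by (auto intro!: derivative_eq_intros simp: field_simps)
  then have "((\<lambda>y. p (norm y) / norm y) has_derivative (\<lambda>h. (p' r - p r / r) / r * (h \<bullet> sgn x))) (at x)"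
    unfolding has_field_derivative_def r_def
    by (rule has_derivative_compose[rotated]) (use \<open>x \<noteq> 0\<close> in \<open>rule has_derivative_norm\<close>)
  from has_derivative_scaleR[OF this has_derivative_ident]
  have "(radial_map p has_derivative (\<lambda>h. (p r / r) *\<^sub>R h + ((p' r - p r / r) / r * (h \<bullet> sgn x)) *\<^sub>R x)) (at x)"
    unfolding radial_map_def[abs_def] r_def .
  also have "(\<lambda>h. (p r / r) *\<^sub>R h + ((p' r - p r / r) / r * (h \<bullet> sgn x)) *\<^sub>R x) = radial_deriv p p' x"
    unfolding radial_deriv_def r_def sgn_div_norm by (auto simp: fun_eq_iff divide_inverse mult_ac)
  finally show ?thesis .
qed

lemma C1_on_radial_map:
  fixes p p' :: "real \<Rightarrow> real"
  assumes I: "I \<subseteq> {0<..}"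
    and p: "\<And>r. r \<in> I \<Longrightarrow> (p has_real_derivative p' r) (at r)"
    and p': "continuous_on I p'"
  shows "C1_on {x. norm x \<in> I} (radial_map p :: 'a::euclidean_space \<Rightarrow> 'a)"
  unfolding C1_on_def
proof (intro exI[of _ "\<lambda>x. Blinfun (radial_deriv p p' x)"] conjI ballI)
  have nz: "x \<noteq> 0" if "norm x \<in> I" for x :: 'a using that I by auto
  have bl: "bounded_linear (radial_deriv p p' x)" for x :: 'a
    unfolding radial_deriv_def[abs_def] by (intro bounded_linear_intros)
  show "(radial_map p has_derivative blinfun_apply (Blinfun (radial_deriv p p' x))) (at x)"
    if "x \<in> {x. norm x \<in> I}" for x :: 'a
    unfolding bounded_linear_Blinfun_apply[OF bl]
    using that nz p by (intro has_derivative_radial_map) auto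
  have cp: "continuous_on I p"
    using p by (meson DERIV_isCont continuous_at_imp_continuous_on)
  let ?S = "{x :: 'a. norm x \<in> I}"
  have "continuous_on ?S (\<lambda>x. p (norm x))" "continuous_on ?S (\<lambda>x. p' (norm x))"
    by (rule continuous_on_compose2[OF cp] continuous_on_compose2[OF p']; force intro: continuous_intros)+
  \<comment> \<open>In finite dimension, continuity in the operator norm reduces to continuity of
    the derivative applied to each fixed \<open>h\<close>.\<close>
  then have "continuous_on ?S (\<lambda>x. radial_deriv p p' x h)" for h
    unfolding radial_deriv_def sgn_div_norm using nz by (intro continuous_intros) auto
  then show "continuous_on ?S (\<lambda>x. Blinfun (radial_deriv p p' x))"
    by (intro continuous_on_blinfun_componentwise) (simp add: bounded_linear_Blinfun_apply[OF bl])
qed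

text \<open>Radial maps compose as their profiles do, so \<open>radial_map q\<close> is the inverse;
  positivity of \<open>I\<close> and \<open>J\<close> keeps both maps away from the origin, where
  they are singular.\<close>

lemma diffeomorphism_radial_map:
  fixes p p' q q' :: "real \<Rightarrow> real"
  assumes I: "I \<subseteq> {0<..}" and J: "J \<subseteq> {0<..}"
    and pq: "\<And>r. r \<in> I \<Longrightarrow> p r \<in> J \<and> q (p r) = r"
    and qp: "\<And>s. s \<in> J \<Longrightarrow> q s \<in> I \<and> p (q s) = s"
    and p: "\<And>r. r \<in> I \<Longrightarrow> (p has_real_derivative p' r) (at r)"
    and q: "\<And>s. s \<in> J \<Longrightarrow> (q has_real_derivative q' s) (at s)"
    and p': "continuous_on I p'" and q': "continuous_on J q'"
  shows "diffeomorphism {x. norm x \<in> I} {x. norm x \<in> J} (radial_map p :: 'a::euclidean_space \<Rightarrow> 'a)"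
proof -
  have C1: "C1_on {x. norm x \<in> I} (radial_map p :: 'a \<Rightarrow> 'a)"
    by (rule C1_on_radial_map[OF I p p'])
  have C1': "C1_on {x. norm x \<in> J} (radial_map q :: 'a \<Rightarrow> 'a)"
    by (rule C1_on_radial_map[OF J q q'])
  have cont: "continuous_on S f" if "C1_on S f" for S and f :: "'a \<Rightarrow> 'a"
    using that unfolding C1_on_def
    by (meson continuous_at_imp_continuous_on has_derivative_continuous)
  have inv: "norm (radial_map p x) \<in> J \<and> radial_map q (radial_map p x) = x"
    if "norm x \<in> I" for x :: 'a
  proof -
    have "x \<noteq> 0" "p (norm x) > 0" using that I J pq by auto
    then show ?thesis using pq that by (simp add: norm_radial_map radial_map_compose)
  qed
  have inv': "norm (radial_map q x) \<in> I \<and> radial_map p (radial_map q x) = x"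
    if "norm x \<in> J" for x :: 'a
  proof -
    have "x \<noteq> 0" "q (norm x) > 0" using that I J qp by auto
    then show ?thesis using qp that by (simp add: norm_radial_map radial_map_compose)
  qed
  have "homeomorphism {x. norm x \<in> I} {x. norm x \<in> J} (radial_map p :: 'a \<Rightarrow> 'a) (radial_map q)"
    by (rule homeomorphismI) (use cont[OF C1] cont[OF C1'] inv inv' in auto)
  then show ?thesis unfolding diffeomorphism_def using C1 C1' by blast
qed

text \<open>By \<open>le\<close> the radial stretch \<open>v\<close> does not exceed the tangential
  stretch \<open>w\<close>, so the operator norm is at most \<open>w\<close>. The determinant is
  \<open>w ^ (n - 1) * v\<close> in dimension \<open>n\<close>, which leaves the quotient
  \<open>w / v\<close>.\<close>

lemma outer_dilatation_radial_map_le: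
  fixes x :: "real^'n"
  assumes "x \<noteq> 0" and p: "(p has_real_derivative p' (norm x)) (at (norm x))"
    and pos: "p' (norm x) > 0" and le: "norm x * p' (norm x) \<le> p (norm x)"
  shows "outer_dilatation (radial_map p) x \<le> ennreal (p (norm x) / (norm x * p' (norm x)))"
proof -
  define w where "w = p (norm x) / norm x"
  define v where "v = p' (norm x)"
  define L where "L = radial_deriv p p' x"
  have "v > 0" using pos by (simp add: v_def)
  have "v \<le> w" using le \<open>x \<noteq> 0\<close> by (simp add: w_def v_def field_simps)
  have e: "norm (sgn x) = 1" using \<open>x \<noteq> 0\<close> by (simp add: norm_sgn)
  have der: "(radial_map p has_derivative L) (at x)"
    unfolding L_def using assms by (intro has_derivative_radial_map)
  have L: "L = (\<lambda>h. w *\<^sub>R h + (v - w) *\<^sub>R (h \<bullet> sgn x) *\<^sub>R sgn x)"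
    by (simp add: L_def radial_deriv_def[abs_def] w_def v_def)
  have det: "det (matrix L) = w ^ (CARD('n) - 1) * v"
    unfolding L by (subst det_scaling_plus_projection[OF e]) simp
  have "norm (L h) \<le> w * norm h" for h
  proof -
    have "sgn x \<bullet> sgn x = 1" using e by (simp add: dot_square_norm)
    then have "(norm (h - (h \<bullet> sgn x) *\<^sub>R sgn x))\<^sup>2 = (norm h)\<^sup>2 - (h \<bullet> sgn x)\<^sup>2"
      unfolding power2_norm_eq_inner inner_diff_left inner_diff_right inner_scaleR_left inner_scaleR_right
      by (simp add: inner_commute[of "sgn x" h] power2_eq_square)
    then have "(norm (h - (h \<bullet> sgn x) *\<^sub>R sgn x))\<^sup>2 \<le> (norm h)\<^sup>2"
      using zero_le_power2[of "h \<bullet> sgn x"] by linarith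
    then have proj: "norm (h - (h \<bullet> sgn x) *\<^sub>R sgn x) \<le> norm h"
      by (rule power2_le_imp_le) (rule norm_ge_zero)
    \<comment> \<open>The second vector is the orthogonal projection of \<open>h\<close> off the
      radial direction, no longer than \<open>h\<close>; both coefficients are nonnegative, so the
      triangle inequality loses nothing in the sum \<open>v + (w - v) = w\<close>.\<close>
    have "L h = v *\<^sub>R h + (w - v) *\<^sub>R (h - (h \<bullet> sgn x) *\<^sub>R sgn x)"
      by (simp add: L algebra_simps)
    also have "norm \<dots> \<le> v * norm h + (w - v) * norm (h - (h \<bullet> sgn x) *\<^sub>R sgn x)"
      using \<open>v > 0\<close> \<open>v \<le> w\<close> by (intro norm_triangle_le) simp
    also have "\<dots> \<le> v * norm h + (w - v) * norm h"
      using \<open>v \<le> w\<close> proj by (intro add_left_mono mult_left_mono) auto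
    also have "\<dots> = w * norm h" by (simp add: left_diff_distrib)
    finally show ?thesis .
  qed
  then have onorm: "onorm L \<le> w" by (intro onorm_le)
  have "onorm L \<ge> 0" using der by (intro onorm_pos_le has_derivative_bounded_linear)
  have J: "det (matrix L) > 0" unfolding det using \<open>v > 0\<close> \<open>v \<le> w\<close> by simp
  have "onorm L ^ CARD('n) / \<bar>det (matrix L)\<bar> \<le> w ^ CARD('n) / det (matrix L)"
    using J onorm \<open>onorm L \<ge> 0\<close> by (simp add: divide_right_mono power_mono)
  also have "w ^ CARD('n) = w * w ^ (CARD('n) - 1)"
    by (simp flip: power_Suc)
  also have "w * w ^ (CARD('n) - 1) / det (matrix L) = w / v"
    unfolding det using \<open>v > 0\<close> \<open>v \<le> w\<close> by simp
  finally have "onorm L ^ CARD('n) / \<bar>det (matrix L)\<bar> \<le> p (norm x) / (norm x * p' (norm x))"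
    by (simp add: w_def v_def)
  moreover have "outer_dilatation (radial_map p) x = ennreal (onorm L ^ CARD('n) / \<bar>det (matrix L)\<bar>)"
    using J der unfolding outer_dilatation_def Let_def frechet_derivative_at[OF der, symmetric]
    by (auto simp: differentiable_def)
  ultimately show ?thesis by (simp add: ennreal_leI)
qed

section \<open>An integrable dyadic majorant\<close>

text \<open>For \<open>0 < norm x \<le> 1\<close> the sum is comparable to
  \<open>M / norm x\<close>. In dimension at least two the ball of radius \<open>(1/2) ^ j\<close>
  has volume at most a constant times \<open>(1/2) ^ (2 * j)\<close>, so the terms are dominated by
  a geometric series.\<close>

lemma nn_integral_dyadic_cballs_finite:
  assumes "DIM('a::euclidean_space) \<ge> 2" and "M \<ge> 0"
  shows "(\<integral>\<^sup>+x. (\<Sum>j. ennreal (M * 2 ^ j) * indicator (cball (0::'a) ((1/2) ^ j)) x) \<partial>lebesgue) < \<infinity>"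
proof -
  define V where "V = unit_ball_vol (real DIM('a))"
  have V: "V \<ge> 0" by (simp add: V_def)
  have term_le: "ennreal (M * 2 ^ j) * emeasure lebesgue (cball (0::'a) ((1/2) ^ j)) \<le> ennreal (M * V * (1/2) ^ j)" for j
  proof -
    have "((1/2::real) ^ j) ^ DIM('a) \<le> ((1/2) ^ j) ^ 2"
      using assms by (intro power_decreasing) (auto simp: power_le_one)
    then have "M * 2 ^ j * (V * ((1/2) ^ j) ^ DIM('a)) \<le> M * 2 ^ j * (V * ((1/2) ^ j) ^ 2)"
      using assms V by (intro mult_left_mono) auto
    also have "\<dots> = M * V * (1/2) ^ j"
      by (simp add: power_one_over power2_eq_square)
    finally show ?thesis
      using assms V by (simp add: emeasure_cball V_def[symmetric] ennreal_mult[symmetric] ennreal_leI)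
  qed
  have "(\<integral>\<^sup>+x. (\<Sum>j. ennreal (M * 2 ^ j) * indicator (cball (0::'a) ((1/2) ^ j)) x) \<partial>lebesgue)
      = (\<Sum>j. \<integral>\<^sup>+x. ennreal (M * 2 ^ j) * indicator (cball (0::'a) ((1/2) ^ j)) x \<partial>lebesgue)"
    by (rule nn_integral_suminf) (auto intro!: borel_measurable_times_ennreal borel_measurable_indicator)
  also have "\<dots> = (\<Sum>j. ennreal (M * 2 ^ j) * emeasure lebesgue (cball (0::'a) ((1/2) ^ j)))"
    by (subst nn_integral_cmult_indicator) auto
  also have "\<dots> \<le> (\<Sum>j. ennreal (M * V * (1/2) ^ j))"
    by (intro suminf_le term_le summableI)
  also have "\<dots> < \<infinity>"
    using assms V by (simp add: less_top[symmetric] ennreal_suminf_neq_top summable_mult summable_geometric del: suminf_ennreal2)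
  finally show ?thesis .
qed

lemma dyadic_shell:
  assumes "0 < r" "r \<le> (1::real)"
  obtains j :: nat where "(1/2) ^ Suc j < r" "r \<le> (1/2) ^ j"
proof -
  obtain n where n: "(1/2::real) ^ n < r" using real_arch_pow_inv[OF \<open>0 < r\<close>, of "1/2"] by auto
  define m where "m = (LEAST n. (1/2::real) ^ n < r)"
  have m: "(1/2) ^ m < r" unfolding m_def by (rule LeastI) (rule n)
  \<comment> \<open>The exponent 0 is excluded by \<open>r \<le> 1\<close>.\<close>
  then obtain j where "m = Suc j" using assms by (cases m) auto
  then have "\<not> (1/2) ^ j < r" unfolding m_def by (metis lessI not_less_Least)
  with m \<open>m = Suc j\<close> show ?thesis by (intro that[of j]) auto
qed

section \<open>Obstruction to a continuous extension at the origin\<close>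

lemma radial_map_no_continuous_extension:
  assumes p: "\<And>r. 0 < r \<Longrightarrow> r < 1 \<Longrightarrow> p r \<ge> 1"
  shows "\<not> (\<exists>g. continuous_on (ball 0 1) g \<and> (\<forall>x\<in>ball 0 1 - {0::'a::euclidean_space}. g x = radial_map p x))"
proof
  assume "\<exists>g. continuous_on (ball 0 1) g \<and> (\<forall>x\<in>ball 0 1 - {0::'a}. g x = radial_map p x)"
  then obtain g where cont: "continuous_on (ball 0 1) g"
    and g: "\<And>x. x \<in> ball 0 1 - {0::'a} \<Longrightarrow> g x = radial_map p x" by blast
  obtain e :: 'a where "norm e = 1" using vector_choose_size[of 1] by auto
  \<comment> \<open>Starting at norm 1/2 keeps every \<open>x n\<close> inside the open unit ball
    and off the origin.\<close>
  define x where "x n = inverse (real (Suc (Suc n))) *\<^sub>R e" for n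
  have nx: "norm (x n) = inverse (real (Suc (Suc n)))" for n by (simp add: x_def \<open>norm e = 1\<close>)
  have nx': "0 < norm (x n)" "norm (x n) < 1" for n unfolding nx by (auto simp: field_simps)
  have lim: "x \<longlonglongrightarrow> 0"
    by (rule tendsto_norm_zero_cancel) (unfold nx, rule LIMSEQ_Suc[OF LIMSEQ_inverse_real_of_nat])
  have isc: "isCont g 0" using cont by (simp add: continuous_on_eq_continuous_at)
  have "(\<lambda>n. g (x n)) \<longlonglongrightarrow> g 0" by (rule isCont_tendsto_compose[OF isc lim])
  moreover have "(\<lambda>n. g (- x n)) \<longlonglongrightarrow> g 0"
    by (rule isCont_tendsto_compose[OF isc]) (use tendsto_minus[OF lim] in simp)
  moreover have "g (- x n) = - g (x n)" for n
    using nx'[of n] by (simp add: g radial_map_def)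
  ultimately have "g 0 = - g 0"
    by (auto intro: LIMSEQ_unique tendsto_minus)
  then have "2 *\<^sub>R g 0 = 0" unfolding scaleR_2 eq_neg_iff_add_eq_0 .
  then have "g 0 = 0" by simp
  have "norm (g (x n)) \<ge> 1" for n
  proof -
    have "p (norm (x n)) \<ge> 1" using nx' p by blast
    then show ?thesis using nx'[of n] by (simp add: g norm_radial_map)
  qed
  then have "1 \<le> norm (g 0)"
    using \<open>(\<lambda>n. g (x n)) \<longlonglongrightarrow> g 0\<close> by (intro tendsto_lowerbound[OF tendsto_norm]) auto
  with \<open>g 0 = 0\<close> show False by simp
qed

section \<open>Choice of the map and verification of its properties\<close>

theorem theorem5p1:
  fixes \<phi> :: "ennreal \<Rightarrow> ennreal" and \<delta> :: real
  assumes "convex_ennreal \<phi>"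
    and "mono \<phi>"
    and "\<phi> 0 < ennreal \<delta>"
    and "(\<integral>\<^sup>+\<tau>\<in>{\<delta>..}. 1 / (ennreal \<tau> * gen_inverse \<phi> (ennreal \<tau>)) \<partial>lebesgue) < \<infinity>"
    and "CARD('n::finite) \<ge> 2"
  shows "\<exists>(f :: real^'n \<Rightarrow> real^'n) (R :: real).
           1 < R \<and>
           diffeomorphism (ball 0 1 - {0}) {x. 1 < norm x \<and> norm x < R} f \<and>
           (\<integral>\<^sup>+x\<in>ball 0 1. \<phi> (outer_dilatation f x) \<partial>lebesgue) < \<infinity> \<and>
           \<not> (\<exists>g :: real^'n \<Rightarrow> real^'n.
                continuous_on (ball 0 1) g \<and> (\<forall>x\<in>ball 0 1 - {0}. g x = f x))"
proof -
  \<comment> \<open>Since \<open>ennreal\<close> sends nonpositive reals to 0, the strict bound on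
    \<open>\<phi> 0\<close> forces \<open>\<delta> > 0\<close>.\<close>
  have "0 < ennreal \<delta>" using assms(3) by (rule le_less_trans[rotated]) simp
  then have "\<delta> > 0" by simp
  then obtain a :: "nat \<Rightarrow> real" and M :: real
    where "M > 0" and a: "\<And>j. a j > 0" "summable a" "suminf a \<le> 4"
      and \<phi>_less: "\<And>j. \<phi> (ennreal (40 / a j)) < ennreal (M * 2 ^ j)"
    by (rule dyadic_weights[OF _ assms(4)]) blast
  obtain \<rho> \<rho>' :: "real \<Rightarrow> real"
    where \<rho>0: "\<rho> 0 = 1" and cont: "continuous_on {0..} \<rho>"
      and der: "\<And>r. r > 0 \<Longrightarrow> (\<rho> has_real_derivative \<rho>' r) (at r)"
      and cont': "continuous_on {0<..} \<rho>'"
      and pos: "\<And>r. r > 0 \<Longrightarrow> \<rho>' r > 0"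
      and le: "\<And>r. r > 0 \<Longrightarrow> r * \<rho>' r \<le> \<rho> r"
      and K: "\<And>j r. (1/2) ^ Suc j \<le> r \<Longrightarrow> r \<le> (1/2) ^ j \<Longrightarrow> \<rho> r / (r * \<rho>' r) \<le> 40 / a j"
    using radial_profile[OF a] by blast
  \<comment> \<open>The profile is inverted on radii below 1; the outer radius of the ring will be
    \<open>R = \<rho> 1\<close>.\<close>
  obtain \<sigma> where less: "\<rho> 0 < \<rho> 1"
    and \<sigma>\<rho>: "\<And>r. r \<in> {0<..<1} \<Longrightarrow> \<rho> r \<in> {\<rho> 0<..<\<rho> 1} \<and> \<sigma> (\<rho> r) = r"
    and \<rho>\<sigma>: "\<And>s. s \<in> {\<rho> 0<..<\<rho> 1} \<Longrightarrow> \<sigma> s \<in> {0<..<1} \<and> \<rho> (\<sigma> s) = s"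
    and der\<sigma>: "\<And>s. s \<in> {\<rho> 0<..<\<rho> 1} \<Longrightarrow> (\<sigma> has_real_derivative inverse (\<rho>' (\<sigma> s))) (at s)"
    and cont\<sigma>: "continuous_on {\<rho> 0<..<\<rho> 1} (\<lambda>s. inverse (\<rho>' (\<sigma> s)))"
  proof (rule inverse_profile[of 0 1 \<rho> \<rho>'])
    show "continuous_on {0..1} \<rho>" by (rule continuous_on_subset[OF cont]) auto
    show "continuous_on {0<..<1} \<rho>'" by (rule continuous_on_subset[OF cont']) auto
  qed (use der pos in auto)
  define f where "f = (radial_map \<rho> :: real^'n \<Rightarrow> real^'n)"
  have "diffeomorphism {x. norm x \<in> {0<..<1}} {x. norm x \<in> {\<rho> 0<..<\<rho> 1}} f"
    unfolding f_def
    by (rule diffeomorphism_radial_map[OF _ _ \<sigma>\<rho> \<rho>\<sigma> _ der\<sigma> _ cont\<sigma>])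
      (use \<rho>0 der in \<open>auto intro: continuous_on_subset[OF cont']\<close>)
  also have "{x :: real^'n. norm x \<in> {0<..<1}} = ball 0 1 - {0}" by auto
  also have "{x :: real^'n. norm x \<in> {\<rho> 0<..<\<rho> 1}} = {x. 1 < norm x \<and> norm x < \<rho> 1}"
    by (auto simp: \<rho>0)
  finally have diffeo: "diffeomorphism (ball 0 1 - {0}) {x. 1 < norm x \<and> norm x < \<rho> 1} f" .
  have bound: "\<phi> (outer_dilatation f x) * indicator (ball 0 1) x
      \<le> (\<Sum>j. ennreal (M * 2 ^ j) * indicator (cball 0 ((1/2) ^ j)) x)" for x
  proof (cases "x = 0")
    case True
    \<comment> \<open>The dilatation at \<open>0\<close> is infinite, but so is the right-hand side.\<close>
    have "(\<Sum>j. ennreal (M * 2 ^ j)) = \<infinity>"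
    proof (rule ccontr)
      assume "(\<Sum>j. ennreal (M * 2 ^ j)) \<noteq> \<infinity>"
      then have "summable (\<lambda>j. M * 2 ^ j)"
        using \<open>M > 0\<close> by (intro summable_suminf_not_top) auto
      then have "summable (\<lambda>j. (2::real) ^ j)" using \<open>M > 0\<close> by (simp add: summable_cmult_iff)
      then show False by (simp add: summable_geometric_iff)
    qed
    then show ?thesis using True by simp
  next
    case False
    show ?thesis
    proof (cases "norm x < 1")
      case True
      obtain j where j: "(1/2) ^ Suc j < norm x" "norm x \<le> (1/2) ^ j"
        using dyadic_shell[of "norm x"] True False by auto
      have "outer_dilatation f x \<le> ennreal (\<rho> (norm x) / (norm x * \<rho>' (norm x)))"
        unfolding f_def using False by (intro outer_dilatation_radial_map_le der pos le) auto
      also have "\<dots> \<le> ennreal (40 / a j)" using j by (intro ennreal_leI K) auto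
      finally have "\<phi> (outer_dilatation f x) \<le> ennreal (M * 2 ^ j)"
        using \<open>mono \<phi>\<close> \<phi>_less[of j] by (meson monoD order_trans less_imp_le)
      \<comment> \<open>The ball of index \<open>j\<close> contains \<open>x\<close>, and its term
        alone is already large enough.\<close>
      also have "\<dots> = (\<Sum>j\<in>{j}. ennreal (M * 2 ^ j) * indicator (cball 0 ((1/2) ^ j)) x)"
        using j by simp
      also have "\<dots> \<le> (\<Sum>j. ennreal (M * 2 ^ j) * indicator (cball 0 ((1/2) ^ j)) x)"
        by (intro sum_le_suminf summableI) auto
      finally show ?thesis using True by simp
    qed simp
  qed
  have "(\<integral>\<^sup>+x\<in>ball 0 1. \<phi> (outer_dilatation f x) \<partial>lebesgue)
      \<le> (\<integral>\<^sup>+x. (\<Sum>j. ennreal (M * 2 ^ j) * indicator (cball (0::real^'n) ((1/2) ^ j)) x) \<partial>lebesgue)"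
    by (intro nn_integral_mono bound)
  also have "\<dots> < \<infinity>"
    using assms(5) \<open>M > 0\<close> by (intro nn_integral_dyadic_cballs_finite) auto
  finally have int: "(\<integral>\<^sup>+x\<in>ball 0 1. \<phi> (outer_dilatation f x) \<partial>lebesgue) < \<infinity>" .
  \<comment> \<open>Read off from the range of the profile, which starts at
    \<open>\<rho> 0 = 1\<close>.\<close>
  have "\<rho> r \<ge> 1" if "0 < r" "r < 1" for r
    using \<sigma>\<rho>[of r] that \<rho>0 by auto
  then have "\<not> (\<exists>g. continuous_on (ball 0 1) g \<and> (\<forall>x\<in>ball 0 1 - {0}. g x = f x))"
    unfolding f_def by (rule radial_map_no_continuous_extension)
  with less \<rho>0 diffeo int show ?thesis by (intro exI[of _ f] exI[of _ "\<rho> 1"]) auto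
qed

end
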